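(* Let $G$ be a graph of order $n\geq 3$ such that the complement $\overline{G}$ is bipartite and $e(\overline{G}) \leq n-3$. Then $q(G) = 2$.
   Context: All graphs are finite and simple; $\overline{G}$ denotes the complement of $G$ and $e(H)$ the number of edges of a graph $H$. For a graph $G$ on $n$ vertices, $\mathcal{S}(G)$ is the set of real symmetric $n\times n$ matrices $A=[a_{ij}]$ such that for $i\neq j$, $a_{ij}\neq 0$ if and only if $ij$ is an edge of $G$ (diagonal entries are unrestricted). For a symmetric matrix $A$, $q(A)$ is the number of distinct eigenvalues of $A$, and $q(G)=\min\{q(A) : A\in\mathcal{S}(G)\}$. *)

theory Defs
  imports "Jordan_Normal_Form.Spectral_Radius"
begin

text \<open>
  A graph of order \<open>n\<close> is given by the vertex set \<open>{..<n}\<close> (the index set of the rows and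
  columns of an \<open>n \<times> n\<close> matrix) and a set \<open>E\<close> of edges, which are two-element sets of vertices.
\<close>

definition all_pairs :: "nat \<Rightarrow> nat set set" where
  "all_pairs n = {e. e \<subseteq> {..<n} \<and> card e = 2}"

definition simple_graph :: "nat \<Rightarrow> nat set set \<Rightarrow> bool" where
  "simple_graph n E \<longleftrightarrow> E \<subseteq> all_pairs n"

definition compl_edges :: "nat \<Rightarrow> nat set set \<Rightarrow> nat set set" where
  "compl_edges n E = all_pairs n - E"

text \<open>A colour class may be empty; in particular, a graph without edges is bipartite.\<close>

definition bipartite :: "nat \<Rightarrow> nat set set \<Rightarrow> bool" where
  "bipartite n E \<longleftrightarrow>
     (\<exists>X Y. X \<union> Y = {..<n} \<and> X \<inter> Y = {} \<and> (\<forall>e\<in>E. \<exists>x\<in>X. \<exists>y\<in>Y. e = {x, y}))"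

definition sym_matrices :: "nat \<Rightarrow> nat set set \<Rightarrow> real mat set" where
  "sym_matrices n E =
     {A \<in> carrier_mat n n. transpose_mat A = A \<and>
        (\<forall>i<n. \<forall>j<n. i \<noteq> j \<longrightarrow> (A $$ (i, j) \<noteq> 0 \<longleftrightarrow> {i, j} \<in> E))}"

text \<open>
  The spectrum is taken over the reals; a real symmetric matrix has no other complex eigenvalues.
\<close>

definition q_mat :: "real mat \<Rightarrow> nat" where
  "q_mat A = card (spectrum A)"

definition q_graph :: "nat \<Rightarrow> nat set set \<Rightarrow> nat" where
  "q_graph n E = (INF A\<in>sym_matrices n E. q_mat A)"

text \<open>The infimum is a minimum, since the set of matrices is never empty.\<close>

lemma adjacency_in_sym_matrices:
  "mat n n (\<lambda>(i, j). if i \<noteq> j \<and> {i, j} \<in> E then 1 else 0) \<in> sym_matrices n E"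
  unfolding sym_matrices_def by (auto simp: insert_commute intro!: eq_matI)

lemma q_graph_attained: "\<exists>A\<in>sym_matrices n E. q_graph n E = q_mat A"
proof -
  have "q_mat ` sym_matrices n E \<noteq> {}"
    using adjacency_in_sym_matrices by blast
  from Inf_nat_def1[OF this] show ?thesis
    unfolding q_graph_def by blast
qed

lemma q_graph_le: "A \<in> sym_matrices n E \<Longrightarrow> q_graph n E \<le> q_mat A"
  unfolding q_graph_def by (auto intro: cINF_lower)

end

theory Submission
  imports Defs
begin

text \<open>
  Choose the bipartition \<open>X, Y\<close> of the complement \<open>F\<close> such that the edges of the graph between
  \<open>X\<close> and \<open>Y\<close> form a connected bipartite graph \<open>H\<close>.  A count of the edges of \<open>F\<close> shows that any
  bipartition will do, unless some vertex is joined in \<open>F\<close> to the whole opposite class; in that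
  case \<open>F\<close> has two isolated vertices, and it suffices to put them on opposite sides.

  Let \<open>M\<close> be a small multiple of the adjacency matrix of \<open>H\<close> and \<open>D\<close> the diagonal matrix with entries
  \<open>1\<close> on \<open>X\<close> and \<open>-1\<close> on \<open>Y\<close>.  Then \<open>R = sqrt (I - M^2)\<close> commutes with \<open>D\<close> and \<open>M\<close>, while \<open>D\<close> and \<open>M\<close>
  anticommute, so \<open>A = D R + M\<close> satisfies \<open>A^2 = I\<close>.  Connectedness of \<open>H\<close> makes all off-diagonal
  entries of \<open>R\<close>
  inside \<open>X\<close> and inside \<open>Y\<close> nonzero, so \<open>A\<close> has the pattern of the graph.

  Conversely, a symmetric matrix with a single eigenvalue \<open>r\<close> is \<open>r I\<close>: for \<open>N = A - r I\<close> the Schur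
  form of \<open>N\<close> is strictly upper triangular, so \<open>trace (N^2)\<close>, the sum of the squares of the entries
  of \<open>N\<close>, vanishes.
\<close>

subsection \<open>Bipartitions with connected cross graph\<close>

text \<open>One class determines the bipartition: the other is \<open>-X\<close>, taken among all
  naturals, so that exchanging the classes is complementation.\<close>

definition separates :: "nat set \<Rightarrow> nat set set \<Rightarrow> bool" where
  "separates X F \<longleftrightarrow> (\<forall>e\<in>F. \<exists>x\<in>X. \<exists>y\<in>-X. e = {x, y})"

lemma separates_Compl:
  assumes "separates X F"
  shows "separates (-X) F"
  unfolding separates_def
proof
  fix e assume "e \<in> F"
  then have "\<exists>x\<in>X. \<exists>y\<in>-X. e = {x, y}" using assms unfolding separates_def by (rule bspec[rotated])
  then obtain x y where xy: "x \<in> X" "y \<in> -X" "e = {x, y}" by (elim bexE)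
  have "e = {y, x}" unfolding xy(3) by (rule insert_commute)
  moreover have "x \<in> - (-X)" using xy(1) by simp
  ultimately show "\<exists>x\<in>-X. \<exists>y\<in>- (-X). e = {x, y}" using xy(2) by (intro bexI)
qed

text \<open>Let \<open>k\<close> vertices below \<open>n\<close> lie in \<open>X\<close>. The star
  at \<open>y\<close> uses up \<open>k\<close> edges of \<open>F\<close>, and each other edge has
  only one end outside \<open>X\<close>. So at most \<open>n - 3 - k\<close> edges are left to meet
  the \<open>n - k - 1\<close> vertices outside \<open>X\<close> other than \<open>y\<close>, and
  two of these stay isolated.\<close>

lemma two_isolated_vertices:
  assumes F: "F \<subseteq> all_pairs n" "separates X F" "card F + 3 \<le> n"
    and y: "y < n" "y \<notin> X" "\<And>x. x < n \<Longrightarrow> x \<in> X \<Longrightarrow> {x, y} \<in> F"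
  shows "\<exists>z<n. \<exists>w<n. z \<noteq> w \<and> z \<notin> \<Union>F \<and> w \<notin> \<Union>F"
proof -
  have "finite F" using F(1) by (rule finite_subset) (simp add: all_pairs_def)
  have "\<forall>e\<in>F. \<exists>y. \<forall>v\<in>e. v \<notin> X \<longrightarrow> v = y"
    using F(2) unfolding separates_def by fastforce
  \<comment> \<open>\<open>f e\<close> is the end of \<open>e\<close> outside
    \<open>X\<close>.\<close>
  from bchoice[OF this] obtain f where f: "\<forall>e\<in>F. \<forall>v\<in>e. v \<notin> X \<longrightarrow> v = f e" ..
  define F1 where "F1 = (\<lambda>x. {x, y}) ` ({..<n} \<inter> X)"
  define W where "W = {..<n} - X - f ` (F - F1) - {y}"
  have F1: "F1 \<subseteq> F" using y(3) by (auto simp: F1_def)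
  have "inj_on (\<lambda>x. {x, y}) ({..<n} \<inter> X)"
    using y(2) by (auto simp: inj_on_def doubleton_eq_iff)
  then have "card F1 = card ({..<n} \<inter> X)" by (simp add: F1_def card_image)
  moreover have "card F1 \<le> card F" by (rule card_mono[OF \<open>finite F\<close> F1])
  moreover have "card (F - F1) = card F - card F1"
    using F1 \<open>finite F\<close> by (simp add: card_Diff_subset finite_subset)
  moreover have "card (f ` (F - F1)) \<le> card (F - F1)"
    using \<open>finite F\<close> by (simp add: card_image_le)
  moreover have "card ({..<n} - X) = n - card ({..<n} \<inter> X)" by (simp add: card_Diff_subset_Int)
  moreover have "card ({..<n} - X) - card (f ` (F - F1)) \<le> card ({..<n} - X - f ` (F - F1))"
    using \<open>finite F\<close> by (intro diff_card_le_card_Diff) simp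
  moreover have "card ({..<n} - X - f ` (F - F1)) - 1 \<le> card W"
    unfolding W_def using diff_card_le_card_Diff[of "{y}"] by simp
  ultimately have "\<not> card W \<le> Suc 0" using F(3) by linarith
  then obtain z w where zw: "z \<in> W" "w \<in> W" "z \<noteq> w"
    using card_le_Suc0_iff_eq[of W] by (auto simp: W_def)
  have "v \<notin> \<Union>F" if "v \<in> W" for v
  proof
    assume "v \<in> \<Union>F"
    then obtain e where e: "e \<in> F" "v \<in> e" by blast
    have "v \<notin> X" using that by (simp add: W_def)
    then have "v = f e" using f e by blast
    then have "e \<in> F1" using e(1) that by (auto simp: W_def)
    then show False using e that by (auto simp: F1_def W_def)
  qed
  then have "z \<notin> \<Union>F" "w \<notin> \<Union>F" using zw(1,2) by simp_all
  moreover have "z < n" "w < n" using zw(1,2) unfolding W_def by simp_all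
  ultimately show ?thesis using zw(3) by (intro exI[of _ z] exI[of _ w] conjI)
qed

text \<open>Connectedness of \<open>H\<close> in cut form, without paths; its negation yields the
  cut whose edges are counted.\<close>

definition cross_connected :: "nat \<Rightarrow> nat set \<Rightarrow> nat set set \<Rightarrow> bool" where
  "cross_connected n X F \<longleftrightarrow> (\<forall>S. S \<subseteq> {..<n} \<longrightarrow> S \<noteq> {} \<longrightarrow> S \<noteq> {..<n} \<longrightarrow>
     (\<exists>u\<in>S. \<exists>v\<in>{..<n} - S. (u \<in> X) \<noteq> (v \<in> X) \<and> {u, v} \<notin> F))"

text \<open>In \<open>H\<close> each of \<open>z\<close> and \<open>w\<close> is adjacent to its
  whole opposite class, so their stars cover all vertices and share the edge
  \<open>{z, w}\<close>.\<close>

lemma cross_connected_if_isolated: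
  assumes "z \<in> X" "z < n" "z \<notin> \<Union>F" "w \<notin> X" "w < n" "w \<notin> \<Union>F"
  shows "cross_connected n X F"
  unfolding cross_connected_def
proof (intro allI impI, rule ccontr)
  fix S assume S: "S \<subseteq> {..<n}" "S \<noteq> {}" "S \<noteq> {..<n}"
    and "\<not> (\<exists>u\<in>S. \<exists>v\<in>{..<n} - S. (u \<in> X) \<noteq> (v \<in> X) \<and> {u, v} \<notin> F)"
  then have same: "u \<in> S \<longleftrightarrow> v \<in> S" if "u < n" "v < n" "(u \<in> X) \<noteq> (v \<in> X)" "{u, v} \<notin> F" for u v
    using that by (metis DiffI insert_commute lessThan_iff)
  have "z \<in> S \<longleftrightarrow> w \<in> S" by (rule same) (use assms in auto)
  moreover have "z \<in> S \<longleftrightarrow> v \<in> S" if "v < n" "v \<notin> X" for v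
    by (rule same) (use assms that in auto)
  moreover have "w \<in> S \<longleftrightarrow> v \<in> S" if "v < n" "v \<in> X" for v
    by (rule same) (use assms that in auto)
  ultimately have "v \<in> S \<longleftrightarrow> z \<in> S" if "v < n" for v using that by metis
  then show False using S by blast
qed

text \<open>If no edge of \<open>H\<close> crosses a cut, then \<open>F\<close> contains all
  bichromatic pairs across it. The cut and the colouring give four parts; if all are nonempty,
  \<open>p * q \<ge> p + q - 1\<close> forces at least \<open>n - 2\<close> edges in
  \<open>F\<close>, too many.\<close>

lemma cross_connected_or_isolated:
  assumes F: "F \<subseteq> all_pairs n" "separates X F" "card F + 3 \<le> n"
  shows "cross_connected n X F \<or> (\<exists>z<n. \<exists>w<n. z \<noteq> w \<and> z \<notin> \<Union>F \<and> w \<notin> \<Union>F)"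
proof (rule disjCI, rule ccontr)
  assume no_iso: "\<not> (\<exists>z<n. \<exists>w<n. z \<noteq> w \<and> z \<notin> \<Union>F \<and> w \<notin> \<Union>F)"
  assume "\<not> cross_connected n X F"
  then obtain S where S: "S \<subseteq> {..<n}" "S \<noteq> {}" "{..<n} - S \<noteq> {}"
    and cut: "\<And>u v. u \<in> S \<Longrightarrow> v \<in> {..<n} - S \<Longrightarrow> (u \<in> X) \<noteq> (v \<in> X) \<Longrightarrow> {u, v} \<in> F"
    unfolding cross_connected_def by blast
  have "finite F" using F(1) by (rule finite_subset) (simp add: all_pairs_def)
  \<comment> \<open>If \<open>T\<close> misses the class \<open>Z\<close>, all of \<open>Z\<close>
    lies across the cut, so a vertex of \<open>T\<close> is joined in \<open>F\<close> to the whole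
    of \<open>Z\<close>.\<close>
  have meets: "T \<inter> Z \<noteq> {}"
    if T: "T \<subseteq> {..<n}" "T \<noteq> {}" and Z: "Z = X \<or> Z = -X"
      and cut: "\<And>u v. u \<in> T \<Longrightarrow> v \<in> {..<n} - T \<Longrightarrow> (u \<in> X) \<noteq> (v \<in> X) \<Longrightarrow> {u, v} \<in> F" for T Z
  proof
    assume TZ: "T \<inter> Z = {}"
    obtain y where y: "y \<in> T" "y < n" "y \<notin> Z" using T TZ by auto
    have "{x, y} \<in> F" if "x < n" "x \<in> Z" for x
      using cut[of y x] y that TZ Z by (auto simp: insert_commute)
    moreover have "separates Z F" using Z F(2) separates_Compl by auto
    ultimately show False using two_isolated_vertices[OF F(1) _ F(3), of Z y] y no_iso by blast
  qed
  define a b a' b' where "a = S \<inter> X" and "b = S \<inter> -X"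
    and "a' = ({..<n} - S) \<inter> X" and "b' = ({..<n} - S) \<inter> -X"
  note defs = a_def b_def a'_def b'_def
  have fin: "finite a" "finite b" "finite a'" "finite b'"
    using S(1) finite_subset by (auto simp: defs)
  have cut': "{u, v} \<in> F" if "u \<in> {..<n} - S" "v \<in> {..<n} - ({..<n} - S)" "(u \<in> X) \<noteq> (v \<in> X)" for u v
    using cut[of v u] that by (auto simp: insert_commute)
  have "a \<noteq> {}" unfolding a_def by (rule meets) (use S cut in auto)
  moreover have "b \<noteq> {}" unfolding b_def by (rule meets) (use S cut in auto)
  moreover have "a' \<noteq> {}" unfolding a'_def by (rule meets) (use S cut' in auto)
  moreover have "b' \<noteq> {}" unfolding b'_def by (rule meets) (use S cut' in auto)
  ultimately have ne: "0 < card a" "0 < card b" "0 < card a'" "0 < card b'"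
    using fin by (simp_all add: card_gt_0_iff)
  let ?P = "a \<times> b' \<union> a' \<times> b"
  have "inj_on (\<lambda>(u, v). {u, v}) ?P"
    by (auto simp: inj_on_def doubleton_eq_iff defs)
  moreover have "(\<lambda>(u, v). {u, v}) ` ?P \<subseteq> F"
    using cut cut' S(1) by (auto simp: defs)
  ultimately have "card ?P \<le> card F" by (rule card_inj_on_le[OF _ _ \<open>finite F\<close>])
  moreover have "card ?P = card a * card b' + card a' * card b"
    using fin by (subst card_Un_disjoint) (auto simp: defs card_cartesian_product)
  moreover have "card (a \<union> b \<union> a' \<union> b') = card a + card b + card a' + card b'"
    using fin by (subst card_Un_disjoint; auto simp: defs)+
  moreover have "a \<union> b \<union> a' \<union> b' = {..<n}" using S(1) by (auto simp: defs)
  moreover have "p + q \<le> p * q + 1" if "0 < p" "0 < q" for p q :: nat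
    using that by (cases p; cases q) auto
  then have "card a + card b' \<le> card a * card b' + 1" "card a' + card b \<le> card a' * card b + 1"
    using ne by simp_all
  ultimately show False using F(3) by simp
qed

lemma exists_cross_connected_bipartition:
  assumes F: "F \<subseteq> all_pairs n" "bipartite n F" "card F + 3 \<le> n"
  obtains X where "separates X F" "cross_connected n X F"
proof -
  from F(2) obtain X0 Y0 where XY: "X0 \<inter> Y0 = {}" "\<forall>e\<in>F. \<exists>x\<in>X0. \<exists>y\<in>Y0. e = {x, y}"
    unfolding bipartite_def by (elim exE conjE)
  have "Y0 \<subseteq> - X0" using XY(1) by blast
  then have sep: "separates X0 F"
    using XY(2) unfolding separates_def by (meson subset_iff)
  consider "cross_connected n X0 F"
    | z w where "z < n" "w < n" "z \<noteq> w" "z \<notin> \<Union>F" "w \<notin> \<Union>F"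
    using cross_connected_or_isolated[OF F(1) sep F(3)] by blast
  then show thesis
  proof cases
    case 1
    then show thesis using sep that by blast
  next
    case 2
    \<comment> \<open>Recolouring vertices that are isolated in \<open>F\<close> affects no edge of
      \<open>F\<close>.\<close>
    have "separates (insert z (X0 - {w})) F"
      unfolding separates_def
    proof
      fix e assume "e \<in> F"
      then obtain x y where xy: "x \<in> X0" "y \<in> - X0" "e = {x, y}"
        using sep unfolding separates_def by blast
      then have "x \<noteq> w" "y \<noteq> z" using 2 \<open>e \<in> F\<close> by auto
      then have "x \<in> insert z (X0 - {w})" "y \<in> - insert z (X0 - {w})" using xy by simp_all
      then show "\<exists>x\<in>insert z (X0 - {w}). \<exists>y\<in>- insert z (X0 - {w}). e = {x, y}"
        using xy(3) by (intro bexI)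
    qed
    moreover have "cross_connected n (insert z (X0 - {w})) F"
      using 2 by (intro cross_connected_if_isolated[of z _ n F w]) auto
    ultimately show thesis by (rule that)
  qed
qed

subsection \<open>Square roots by monotone iteration\<close>

text \<open>Matrices are functions on all pairs of naturals, with only the summation bounded by
  \<open>n\<close>; associativity is then an equation of functions without dimension
  conditions.\<close>

definition mat_prod :: "nat \<Rightarrow> (nat \<Rightarrow> nat \<Rightarrow> real) \<Rightarrow> (nat \<Rightarrow> nat \<Rightarrow> real) \<Rightarrow> nat \<Rightarrow> nat \<Rightarrow> real" where
  "mat_prod n f g i j = (\<Sum>l<n. f i l * g l j)"

lemma mat_prod_assoc: "mat_prod n (mat_prod n f g) h = mat_prod n f (mat_prod n g h)"
proof (intro ext)
  fix i j
  have "mat_prod n (mat_prod n f g) h i j = (\<Sum>l<n. \<Sum>k<n. f i k * g k l * h l j)"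
    by (simp add: mat_prod_def sum_distrib_right)
  also have "\<dots> = (\<Sum>k<n. \<Sum>l<n. f i k * g k l * h l j)"
    by (rule sum.swap)
  finally show "mat_prod n (mat_prod n f g) h i j = mat_prod n f (mat_prod n g h) i j"
    by (simp add: mat_prod_def sum_distrib_left mult.assoc)
qed

lemma mat_prod_nonneg: "(\<And>i j. 0 \<le> f i j) \<Longrightarrow> (\<And>i j. 0 \<le> g i j) \<Longrightarrow> 0 \<le> mat_prod n f g i j"
  by (simp add: mat_prod_def sum_nonneg)

lemma mat_prod_row_sum_le:
  assumes f: "\<And>i j. 0 \<le> f i j"
    and rf: "\<And>i. i < n \<Longrightarrow> (\<Sum>j<n. f i j) \<le> 1" and rg: "\<And>i. i < n \<Longrightarrow> (\<Sum>j<n. g i j) \<le> 1"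
    and i: "i < n"
  shows "(\<Sum>j<n. mat_prod n f g i j) \<le> 1"
proof -
  have "(\<Sum>j<n. mat_prod n f g i j) = (\<Sum>l<n. f i l * (\<Sum>j<n. g l j))"
    unfolding mat_prod_def sum_distrib_left by (rule sum.swap)
  also have "\<dots> \<le> (\<Sum>l<n. f i l * 1)"
    by (intro sum_mono mult_left_mono f) (simp add: rg)
  also have "\<dots> \<le> 1" using rf[OF i] by simp
  finally show ?thesis .
qed

locale symmetric_substochastic =
  fixes n :: nat and M :: "nat \<Rightarrow> nat \<Rightarrow> real"
  assumes nonneg: "0 \<le> M i j"
    and sym: "M i j = M j i"
    and row_sum: "i < n \<Longrightarrow> (\<Sum>j<n. M i j) \<le> 1"
begin

text \<open>
  The iteration solves \<open>(I - Y)^2 = I - M^2\<close> in the form \<open>Y = (M^2 + Y^2) / 2\<close>.  It is entrywise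
  monotone, and the bound \<open>1\<close> on the row sums of \<open>M\<close> is inherited by all iterates.  In the limit
  \<open>M^2 \<le> 2 Y\<close> and \<open>Y^2 \<le> 2 Y\<close> entrywise, so that positivity of the entries of \<open>Y\<close> is a transitive
  relation containing all pairs with a common neighbour.
\<close>

primrec sqrt_iter :: "nat \<Rightarrow> nat \<Rightarrow> nat \<Rightarrow> real" where
  "sqrt_iter 0 = (\<lambda>i j. 0)"
| "sqrt_iter (Suc k) = (\<lambda>i j. (mat_prod n M M i j + mat_prod n (sqrt_iter k) (sqrt_iter k) i j) / 2)"

lemma sqrt_iter_nonneg: "0 \<le> sqrt_iter k i j"
  by (induction k arbitrary: i j) (simp_all add: mat_prod_nonneg nonneg)

lemma sqrt_iter_row_sum: "i < n \<Longrightarrow> (\<Sum>j<n. sqrt_iter k i j) \<le> 1"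
proof (induction k arbitrary: i)
  case (Suc k)
  have "(\<Sum>j<n. mat_prod n M M i j) \<le> 1" "(\<Sum>j<n. mat_prod n (sqrt_iter k) (sqrt_iter k) i j) \<le> 1"
    using Suc by (auto intro!: mat_prod_row_sum_le nonneg row_sum sqrt_iter_nonneg)
  then show ?case by (simp add: sum.distrib flip: sum_divide_distrib)
qed simp

lemma sqrt_iter_le_1: "i < n \<Longrightarrow> j < n \<Longrightarrow> sqrt_iter k i j \<le> 1"
  using member_le_sum[of j "{..<n}" "sqrt_iter k i"] sqrt_iter_row_sum[of i k] sqrt_iter_nonneg
  by fastforce

lemma sqrt_iter_mono: "sqrt_iter k i j \<le> sqrt_iter (Suc k) i j"
proof (induction k arbitrary: i j)
  case 0
  show ?case by (simp add: mat_prod_nonneg nonneg mat_prod_def[of n "\<lambda>i j. 0"])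
next
  case (Suc k)
  have "mat_prod n (sqrt_iter k) (sqrt_iter k) i j \<le> mat_prod n (sqrt_iter (Suc k)) (sqrt_iter (Suc k)) i j"
    unfolding mat_prod_def by (intro sum_mono mult_mono Suc sqrt_iter_nonneg)
  then show ?case by simp
qed

lemma sqrt_iter_sym: "sqrt_iter k i j = sqrt_iter k j i"
proof (induction k arbitrary: i j)
  case (Suc k)
  show ?case by (simp add: mat_prod_def) (simp add: sym[of i] sym[of j] Suc[of i] Suc[of j] mult.commute)
qed simp

lemma mat_prod_mean:
  "mat_prod n (\<lambda>i j. (f i j + g i j) / 2) h i j = (mat_prod n f h i j + mat_prod n g h i j) / 2"
  "mat_prod n h (\<lambda>i j. (f i j + g i j) / 2) i j = (mat_prod n h f i j + mat_prod n h g i j) / 2"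
  by (simp_all add: mat_prod_def ring_distribs add_divide_distrib sum.distrib sum_divide_distrib)

text \<open>Every iterate is a polynomial in \<open>M\<close>.\<close>

lemma sqrt_iter_commute: "mat_prod n (sqrt_iter k) M = mat_prod n M (sqrt_iter k)"
proof (induction k)
  case 0
  show ?case by (simp add: mat_prod_def fun_eq_iff)
next
  case (Suc k)
  have "mat_prod n (mat_prod n (sqrt_iter k) (sqrt_iter k)) M = mat_prod n M (mat_prod n (sqrt_iter k) (sqrt_iter k))"
    by (metis Suc mat_prod_assoc)
  then show ?case by (simp add: fun_eq_iff mat_prod_mean mat_prod_assoc)
qed

text \<open>\<open>M\<close> is block off-diagonal for the colouring \<open>c\<close>, so
  \<open>M^2\<close> and all iterates are block diagonal.\<close>

lemma sqrt_iter_bipartite: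
  fixes c :: "nat \<Rightarrow> bool"
  assumes c: "\<And>i j. c i = c j \<Longrightarrow> M i j = 0"
  shows "c i \<noteq> c j \<Longrightarrow> sqrt_iter k i j = 0"
proof (induction k arbitrary: i j)
  case (Suc k)
  have "M i l * M l j = 0" "sqrt_iter k i l * sqrt_iter k l j = 0" for l
    using Suc.prems c[of i l] c[of l j] Suc.IH[of i l] Suc.IH[of l j] by auto
  then show ?case by (simp add: mat_prod_def)
qed simp

text \<open>\<open>I - Y\<close> will be the square root of \<open>I - M^2\<close>. Convergence is
  shown only for indices below \<open>n\<close>; symmetry and vanishing across colours hold for all
  indices, being inherited from the sequences themselves.\<close>

definition Y :: "nat \<Rightarrow> nat \<Rightarrow> real" where
  "Y i j = lim (\<lambda>k. sqrt_iter k i j)"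

lemma sqrt_iter_tendsto:
  assumes "i < n" "j < n"
  shows "(\<lambda>k. sqrt_iter k i j) \<longlonglongrightarrow> Y i j"
proof -
  have "incseq (\<lambda>k. sqrt_iter k i j)" by (intro incseq_SucI sqrt_iter_mono)
  moreover have "Bseq (\<lambda>k. sqrt_iter k i j)"
    using sqrt_iter_nonneg sqrt_iter_le_1[OF assms] by (intro BseqI'[of _ 1]) (simp add: abs_of_nonneg)
  ultimately have "convergent (\<lambda>k. sqrt_iter k i j)"
    by (intro Bseq_monoseq_convergent) (simp_all add: incseq_imp_monoseq)
  then show ?thesis by (simp add: convergent_LIMSEQ_iff Y_def)
qed

lemma mat_prod_tendsto:
  assumes "\<And>i j. i < n \<Longrightarrow> j < n \<Longrightarrow> (\<lambda>k. f k i j) \<longlonglongrightarrow> f' i j"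
    and "\<And>i j. i < n \<Longrightarrow> j < n \<Longrightarrow> (\<lambda>k. g k i j) \<longlonglongrightarrow> g' i j"
    and "i < n" "j < n"
  shows "(\<lambda>k. mat_prod n (f k) (g k) i j) \<longlonglongrightarrow> mat_prod n f' g' i j"
  unfolding mat_prod_def by (intro tendsto_sum tendsto_mult assms) simp_all

lemma Y_nonneg: "i < n \<Longrightarrow> j < n \<Longrightarrow> 0 \<le> Y i j"
  using sqrt_iter_nonneg by (auto intro: LIMSEQ_le_const[OF sqrt_iter_tendsto])

lemma Y_sym: "Y i j = Y j i"
  unfolding Y_def sqrt_iter_sym[of _ i j] ..

lemma Y_bipartite:
  fixes c :: "nat \<Rightarrow> bool"
  assumes "\<And>i j. c i = c j \<Longrightarrow> M i j = 0" and "c i \<noteq> c j"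
  shows "Y i j = 0"
proof -
  have "sqrt_iter k i j = 0" for k by (rule sqrt_iter_bipartite[of c, OF assms])
  then show ?thesis by (simp add: Y_def)
qed

text \<open>Rearranged, this is \<open>(I - Y)^2 = I - M^2\<close>.\<close>

lemma Y_fixpoint:
  assumes "i < n" "j < n"
  shows "Y i j = (mat_prod n M M i j + mat_prod n Y Y i j) / 2"
proof (rule LIMSEQ_unique)
  show "(\<lambda>k. sqrt_iter (Suc k) i j) \<longlonglongrightarrow> Y i j"
    by (rule LIMSEQ_Suc[OF sqrt_iter_tendsto[OF assms]])
  show "(\<lambda>k. sqrt_iter (Suc k) i j) \<longlonglongrightarrow> (mat_prod n M M i j + mat_prod n Y Y i j) / 2"
    by (auto intro!: tendsto_divide tendsto_add mat_prod_tendsto sqrt_iter_tendsto assms)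
qed

lemma Y_commute:
  assumes "i < n" "j < n"
  shows "mat_prod n Y M i j = mat_prod n M Y i j"
proof (rule LIMSEQ_unique)
  show "(\<lambda>k. mat_prod n (sqrt_iter k) M i j) \<longlonglongrightarrow> mat_prod n Y M i j"
    by (intro mat_prod_tendsto sqrt_iter_tendsto assms) simp_all
  show "(\<lambda>k. mat_prod n (sqrt_iter k) M i j) \<longlonglongrightarrow> mat_prod n M Y i j"
    unfolding sqrt_iter_commute by (intro mat_prod_tendsto sqrt_iter_tendsto assms) simp_all
qed

lemma Y_pos_if_common_neighbour:
  assumes "i < n" "j < n" "l < n" "0 < M i l" "0 < M l j"
  shows "0 < Y i j"
proof -
  have "0 < mat_prod n M M i j"
    unfolding mat_prod_def using assms by (intro sum_pos2[of _ l]) (simp_all add: nonneg)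
  moreover have "0 \<le> mat_prod n Y Y i j"
    unfolding mat_prod_def using assms by (intro sum_nonneg mult_nonneg_nonneg) (simp_all add: Y_nonneg)
  ultimately show ?thesis using Y_fixpoint[of i j] assms by simp
qed

lemma Y_pos_trans:
  assumes "i < n" "j < n" "l < n" "0 < Y i l" "0 < Y l j"
  shows "0 < Y i j"
proof -
  have "0 < mat_prod n Y Y i j"
    unfolding mat_prod_def using assms by (intro sum_pos2[of _ l]) (simp_all add: Y_nonneg)
  then show ?thesis
    using Y_fixpoint[of i j] assms mat_prod_nonneg[of M M n i j] nonneg by simp
qed

text \<open>\<open>R\<close> is the set reached from \<open>i\<close> by positive entries of
  \<open>Y\<close>, and \<open>S\<close> adds the \<open>M\<close>-neighbours of \<open>R\<close>. A
  vertex adjacent to one in \<open>S - R\<close> has a common neighbour with some \<open>r\<close>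
  in \<open>R\<close>, hence lies in \<open>R\<close> itself. So \<open>S\<close> is closed under
  adjacency and contains all vertices.\<close>

lemma Y_pos_if_connected:
  fixes c :: "nat \<Rightarrow> bool"
  assumes conn: "\<And>S. S \<subseteq> {..<n} \<Longrightarrow> S \<noteq> {} \<Longrightarrow> S \<noteq> {..<n} \<Longrightarrow>
      \<exists>u\<in>S. \<exists>v\<in>{..<n} - S. 0 < M u v"
    and bip: "\<And>i j. c i = c j \<Longrightarrow> M i j = 0"
    and ij: "i < n" "j < n" "i \<noteq> j" "c i = c j"
  shows "0 < Y i j"
proof -
  define R where "R = {u. u < n \<and> (u = i \<or> 0 < Y i u)}"
  define S where "S = R \<union> {v. v < n \<and> (\<exists>u\<in>R. 0 < M u v)}"
  have c_R: "c u = c i" if "u \<in> R" for u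
    using Y_bipartite[of c i u, OF bip] that unfolding R_def by fastforce
  have "v \<in> S" if uv: "u \<in> S" "v < n" "0 < M u v" for u v
  proof (cases "u \<in> R")
    case True
    then show ?thesis using uv by (auto simp: S_def)
  next
    case False
    then obtain r where r: "r \<in> R" "0 < M r u" "u < n" using uv by (auto simp: S_def)
    then have "0 < Y r v" "r < n"
      using Y_pos_if_common_neighbour[of r v u] that by (auto simp: R_def)
    then have "0 < Y i v"
      using r(1) Y_pos_trans[of i v r] ij that by (auto simp: R_def)
    then show ?thesis using that by (simp add: S_def R_def)
  qed
  moreover have "S \<subseteq> {..<n}" "i \<in> S" using ij by (auto simp: S_def R_def)
  ultimately have "S = {..<n}" using conn[of S] by blast
  then have "j \<in> S" using ij by simp
  \<comment> \<open>\<open>R\<close> lies in the colour class of \<open>i\<close>, so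
    \<open>j\<close>, having the same colour, is in \<open>S\<close> as a member of \<open>R\<close>
    and not as a neighbour.\<close>
  moreover have "M u j = 0" if "u \<in> R" for u using bip c_R[OF that] ij by simp
  ultimately show ?thesis using ij by (auto simp: S_def R_def)
qed

text \<open>With \<open>D\<close> the diagonal matrix of the signs \<open>d\<close>,
  \<open>A = D (I - Y) + M\<close>. Since \<open>D\<close> commutes with \<open>Y\<close> and
  anticommutes with \<open>M\<close>, and \<open>Y\<close> commutes with \<open>M\<close>, the
  square is \<open>(I - Y)^2 + M^2\<close>.\<close>

lemma signed_sqrt_involution:
  fixes c :: "nat \<Rightarrow> bool"
  defines "d \<equiv> \<lambda>i. if c i then 1 else - 1"
  defines "A \<equiv> \<lambda>i j. d i * ((if i = j then 1 else 0) - Y i j) + M i j"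
  assumes bip: "\<And>i j. c i = c j \<Longrightarrow> M i j = 0"
    and ij: "i < n" "j < n"
  shows "mat_prod n A A i j = (if i = j then 1 else 0)"
proof -
  define \<delta> :: "nat \<Rightarrow> nat \<Rightarrow> real" where "\<delta> a b = (if a = b then 1 else 0)" for a b
  have Yd: "Y a l * d l = d a * Y a l" for a l
    using Y_bipartite[of c a l] bip by (auto simp: d_def)
  have Md: "M a l * d l = - (d a * M a l)" for a l
    using bip[of a l] by (auto simp: d_def)
  have dd: "d a * d a = 1" for a by (simp add: d_def)
  have \<delta>d: "\<delta> a l * d l = d a * \<delta> a l" for a l by (simp add: \<delta>_def)
  \<comment> \<open>Moving all signs to the left leaves four groups, which sum over \<open>l\<close>
    to \<open>(I - Y)^2\<close>, two commutators that vanish, and \<open>M^2\<close>.\<close>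
  have expand: "A i l * A l j = (\<delta> i l * \<delta> l j - \<delta> i l * Y l j - Y i l * \<delta> l j + Y i l * Y l j)
      + d i * (\<delta> i l * M l j - M i l * \<delta> l j) + d i * (M i l * Y l j - Y i l * M l j) + M i l * M l j" for l
  proof -
    have "A i l * A l j = d i * (((\<delta> i l * d l) - Y i l * d l) * (\<delta> l j - Y l j))
        + d i * (\<delta> i l - Y i l) * M l j + (M i l * d l) * (\<delta> l j - Y l j) + M i l * M l j"
      unfolding A_def \<delta>_def[symmetric] by (simp add: algebra_simps)
    also have "\<dots> = (d i * d i) * ((\<delta> i l - Y i l) * (\<delta> l j - Y l j))
        + d i * (\<delta> i l - Y i l) * M l j - d i * M i l * (\<delta> l j - Y l j) + M i l * M l j"
      unfolding \<delta>d Yd Md by (simp add: algebra_simps)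
    finally show ?thesis unfolding dd by (simp add: algebra_simps)
  qed
  have \<delta>_left: "(\<Sum>l<n. \<delta> i l * f l) = f i" and \<delta>_right: "(\<Sum>l<n. f l * \<delta> l j) = f j" for f
    using ij by (simp_all add: \<delta>_def if_distrib if_distribR sum.delta cong: if_cong)
  have "mat_prod n A A i j = (\<delta> i j - Y i j - Y i j + mat_prod n Y Y i j) + d i * (M i j - M i j)
      + d i * (mat_prod n M Y i j - mat_prod n Y M i j) + mat_prod n M M i j"
    unfolding mat_prod_def expand sum.distrib sum_subtractf sum_distrib_left[symmetric] \<delta>_left \<delta>_right ..
  then show ?thesis using Y_fixpoint[OF ij] Y_commute[OF ij] by (simp add: \<delta>_def)
qed

end

subsection \<open>Spectra of symmetric matrices\<close>

definition mat_trace :: "'a :: comm_ring_1 mat \<Rightarrow> 'a" where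
  "mat_trace A = (\<Sum>i<dim_row A. A $$ (i, i))"

lemma mat_mult_entry:
  "A \<in> carrier_mat n n \<Longrightarrow> B \<in> carrier_mat n n \<Longrightarrow> i < n \<Longrightarrow> j < n \<Longrightarrow>
     (A * B) $$ (i, j) = (\<Sum>l<n. A $$ (i, l) * B $$ (l, j))"
  by (auto simp: scalar_prod_def lessThan_atLeast0 intro!: sum.cong)

lemma mat_trace_comm:
  assumes "A \<in> carrier_mat n n" "B \<in> carrier_mat n n"
  shows "mat_trace (A * B) = mat_trace (B * A)"
proof -
  have "mat_trace (A * B) = (\<Sum>i<n. \<Sum>l<n. A $$ (i, l) * B $$ (l, i))"
    using assms by (simp add: mat_trace_def mat_mult_entry del: index_mult_mat(1))
  also have "\<dots> = (\<Sum>l<n. \<Sum>i<n. B $$ (l, i) * A $$ (i, l))"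
    by (subst sum.swap) (simp add: mult.commute)
  also have "\<dots> = mat_trace (B * A)"
    using assms by (simp add: mat_trace_def mat_mult_entry del: index_mult_mat(1))
  finally show ?thesis .
qed

lemma symmetric_mat_entry:
  assumes "A \<in> carrier_mat n n" "transpose_mat A = A" "i < n" "j < n"
  shows "A $$ (i, j) = A $$ (j, i)"
  using assms by (metis carrier_matD index_transpose_mat(1))

text \<open>For an eigenvector \<open>v\<close>, the Hermitian form \<open>H\<close> of
  \<open>A\<close> at \<open>v\<close> is real by symmetry and equals \<open>a\<close> times the
  squared norm \<open>s\<close> of \<open>v\<close>.\<close>

lemma complex_eigenvalue_of_symmetric_real:
  assumes A: "A \<in> carrier_mat n n" and sym: "transpose_mat A = (A :: real mat)"
    and ev: "eigenvalue (map_mat complex_of_real A) a"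
  shows "a \<in> \<real>"
proof -
  obtain v where v: "v \<in> carrier_vec n" "v \<noteq> 0\<^sub>v n"
      "map_mat complex_of_real A *\<^sub>v v = a \<cdot>\<^sub>v v"
    using ev A by (auto simp: eigenvalue_def eigenvector_def)
  have Av: "(\<Sum>j<n. A $$ (i, j) * v $ j) = a * v $ i" if "i < n" for i
  proof -
    have "(map_mat complex_of_real A *\<^sub>v v) $ i = (\<Sum>j<n. A $$ (i, j) * v $ j)"
      using A v(1) that by (auto simp: scalar_prod_def lessThan_atLeast0 intro!: sum.cong)
    then show ?thesis using v that by simp
  qed
  define s where "s = (\<Sum>i<n. (norm (v $ i))\<^sup>2)"
  define H where "H = (\<Sum>i<n. \<Sum>j<n. cnj (v $ i) * A $$ (i, j) * v $ j)"
  have "cnj H = (\<Sum>i<n. \<Sum>j<n. v $ i * A $$ (i, j) * cnj (v $ j))"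
    by (simp add: H_def)
  also have "\<dots> = (\<Sum>j<n. \<Sum>i<n. v $ i * A $$ (i, j) * cnj (v $ j))"
    by (rule sum.swap)
  also have "\<dots> = H"
    unfolding H_def by (intro sum.cong refl) (simp add: symmetric_mat_entry[OF A sym] mult.commute mult.left_commute)
  finally have real_H: "cnj H = H" .
  have "H = (\<Sum>i<n. cnj (v $ i) * (a * v $ i))"
    unfolding H_def using Av by (intro sum.cong refl) (simp add: mult.assoc flip: sum_distrib_left)
  also have "\<dots> = a * s"
    by (simp add: s_def sum_distrib_left complex_norm_square[unfolded of_real_power] mult_ac)
  finally have H: "H = a * s" .
  obtain i where "i < n" "v $ i \<noteq> 0" using v by (auto simp: vec_eq_iff)
  then have "0 < s" unfolding s_def by (intro sum_pos2[of _ i]) simp_all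
  then have "cnj a = a" using real_H by (simp add: H)
  then show ?thesis by (simp add: Reals_cnj_iff)
qed

text \<open>The spectrum is real, but the Schur form is taken of a matrix whose characteristic
  polynomial splits; hence the passage to the complex matrix \<open>C\<close>.\<close>

lemma symmetric_mat_eq_zero:
  assumes N: "N \<in> carrier_mat n n" and sym: "transpose_mat N = (N :: real mat)"
    and spec: "spectrum N \<subseteq> {0}"
    and ij: "i < n" "j < n"
  shows "N $$ (i, j) = 0"
proof -
  define C where "C = map_mat complex_of_real N"
  have C: "C \<in> carrier_mat n n" using N by (simp add: C_def)
  obtain as where as: "char_poly C = (\<Prod>a\<leftarrow>as. [:- a, 1:])"
    using char_poly_factorized[OF C] by blast
  \<comment> \<open>A root of the characteristic polynomial of \<open>C\<close> is real by symmetry,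
    so it is already in the real spectrum of \<open>N\<close>.\<close>
  have zero: "a = 0" if "a \<in> set as" for a
  proof -
    have root: "poly (char_poly C) a = 0" unfolding as using that by (rule linear_poly_root)
    then have "a \<in> \<real>"
      using complex_eigenvalue_of_symmetric_real[OF N sym] eigenvalue_root_char_poly[OF C]
      by (simp add: C_def)
    then obtain r where r: "a = complex_of_real r" by (elim Reals_cases)
    then have "complex_of_real (poly (char_poly N) r) = 0"
      using root by (simp add: C_def of_real_hom.char_poly_hom[OF N])
    then have "r \<in> spectrum N"
      by (simp add: spectrum_def eigenvalue_root_char_poly[OF N])
    then show ?thesis using spec r by auto
  qed
  obtain T P Q where TPQ: "schur_decomposition C as = (T, P, Q)" by (metis prod_cases3)
  have "similar_mat_wit C T P Q" and up: "upper_triangular T" and diag: "diag_mat T = as"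
    using schur_decomposition[OF C as TPQ] by auto
  note w = similar_mat_witD2[OF C this(1)]
  have TT: "(T * T) $$ (k, k) = 0" if "k < n" for k
  proof -
    have "T $$ (k, k) \<in> set as" using that w(5) by (auto simp flip: diag simp: diag_mat_def)
    \<comment> \<open>For \<open>l\<close> other than \<open>k\<close> one factor lies below the
      diagonal; for \<open>l = k\<close> both are an eigenvalue, hence zero.\<close>
    then have "T $$ (k, l) * T $$ (l, k) = 0" if "l < n" for l
      using zero upper_triangularD[OF up, of l k] upper_triangularD[OF up, of k l] that \<open>k < n\<close> w(5)
      by (cases l k rule: linorder_cases) auto
    then have "(\<Sum>l<n. T $$ (k, l) * T $$ (l, k)) = 0" by (intro sum.neutral) simp
    then show ?thesis using w(5) that by (simp add: mat_mult_entry del: index_mult_mat(1))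
  qed
  have "C * C = P * T * Q * (P * T * Q)" using w(3) by simp
  also have "\<dots> = P * (T * T) * Q"
    using w(2,4-7) by (smt (verit) assoc_mult_mat mult_carrier_mat right_mult_one_mat)
  \<comment> \<open>Cyclicity of the trace brings \<open>Q\<close> in front of \<open>P\<close>,
    where they cancel.\<close>
  finally have "mat_trace (C * C) = mat_trace (Q * (P * (T * T)))"
    using w(5-7) by (simp add: mat_trace_comm[of _ n])
  also have "Q * (P * (T * T)) = T * T"
    using w(2,5-7) by (smt (verit) assoc_mult_mat mult_carrier_mat left_mult_one_mat)
  also have "mat_trace (T * T) = 0"
    using w(5) TT by (simp add: mat_trace_def del: index_mult_mat(1))
  finally have "0 = mat_trace (C * C)" by simp
  also have "\<dots> = (\<Sum>k<n. \<Sum>l<n. C $$ (k, l) * C $$ (l, k))"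
    using C by (simp add: mat_trace_def mat_mult_entry del: index_mult_mat(1))
  also have "\<dots> = complex_of_real (\<Sum>k<n. \<Sum>l<n. (N $$ (k, l))\<^sup>2)"
    using N symmetric_mat_entry[OF N sym] by (simp add: C_def power2_eq_square)
  finally have "(\<Sum>k<n. \<Sum>l<n. (N $$ (k, l))\<^sup>2) = 0" by (metis of_real_eq_0_iff)
  then have "(N $$ (i, j))\<^sup>2 = 0"
    using ij by (simp add: sum_nonneg_eq_0_iff sum_nonneg)
  then show ?thesis by simp
qed

lemma two_le_card_spectrum:
  assumes A: "A \<in> carrier_mat n n" and sym: "transpose_mat A = (A :: real mat)"
    and ij: "i < n" "j < n" "i \<noteq> j" "A $$ (i, j) \<noteq> 0"
  shows "2 \<le> card (spectrum A)"
proof (rule ccontr)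
  assume "\<not> 2 \<le> card (spectrum A)"
  \<comment> \<open>Inclusion in \<open>{r}\<close> also covers an empty spectrum. The shift by
    \<open>r\<close> below moves the spectrum into \<open>{0}\<close> and keeps off-diagonal
    entries.\<close>
  then obtain r where r: "spectrum A \<subseteq> {r}"
    using card_le_Suc0_iff_eq[OF card_finite_spectrum(1)[OF A]]
    by (metis insertI1 less_2_cases_iff less_Suc_eq_le not_less numeral_2_eq_2 subsetI singleton_iff)
  define N where "N = char_matrix A r"
  have N: "N \<in> carrier_mat n n" using A by (simp add: N_def)
  have "transpose_mat N = N"
    using A by (intro eq_matI) (auto simp: N_def char_matrix_def symmetric_mat_entry[OF A sym])
  moreover have "spectrum N \<subseteq> {0}"
  proof
    fix k assume "k \<in> spectrum N"
    moreover have "char_matrix N k = char_matrix A (k + r)"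
      using A by (intro eq_matI) (auto simp: N_def char_matrix_def)
    ultimately have "k + r \<in> spectrum A"
      by (simp add: spectrum_def eigenvalue_def eigenvector_char_matrix[OF A] eigenvector_char_matrix[OF N])
    then show "k \<in> {0}" using r by auto
  qed
  ultimately have "N $$ (i, j) = 0" using N ij by (intro symmetric_mat_eq_zero)
  then show False using A ij by (simp add: N_def char_matrix_def)
qed

lemma card_spectrum_involution_le:
  assumes A: "A \<in> carrier_mat n n" and inv: "A * A = (1\<^sub>m n :: real mat)"
  shows "card (spectrum A) \<le> 2"
proof -
  have "spectrum A \<subseteq> {1, -1}"
  proof
    fix k assume "k \<in> spectrum A"
    then obtain v where v: "v \<in> carrier_vec n" "v \<noteq> 0\<^sub>v n" "A *\<^sub>v v = k \<cdot>\<^sub>v v"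
      using A by (auto simp: spectrum_def eigenvalue_def eigenvector_def)
    have "v = A *\<^sub>v (A *\<^sub>v v)"
      using A v(1) inv by (simp flip: assoc_mult_mat_vec)
    also have "\<dots> = (k * k) \<cdot>\<^sub>v v"
      using A v by (simp add: mult_mat_vec smult_smult_assoc)
    finally have eq: "v = (k * k) \<cdot>\<^sub>v v" .
    obtain i where "i < n" "v $ i \<noteq> 0" using v by (auto simp: vec_eq_iff)
    moreover have "v $ i = k * k * v $ i"
      using arg_cong[OF eq, of "\<lambda>v. v $ i"] v(1) \<open>i < n\<close> by simp
    ultimately have "k * k = 1" by simp
    then show "k \<in> {1, -1}" by (simp add: square_eq_1_iff)
  qed
  then have "card (spectrum A) \<le> card {1, -1 :: real}" by (intro card_mono) simp_all
  then show ?thesis by simp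
qed

section \<open>A matrix with two eigenvalues, and the lower bound from a single edge\<close>

theorem theorem3p7:
  fixes n :: nat and E :: "nat set set"
  assumes "simple_graph n E"
    and "n \<ge> 3"
    and "bipartite n (compl_edges n E)"
    and "card (compl_edges n E) \<le> n - 3"
  shows "q_graph n E = 2"
proof -
  let ?F = "compl_edges n E"
  have F: "?F \<subseteq> all_pairs n" by (auto simp: compl_edges_def)
  \<comment> \<open>With \<open>n \<ge> 3\<close> the subtraction on naturals is not
    truncated.\<close>
  have "card ?F + 3 \<le> n" using assms(2,4) by linarith
  from exists_cross_connected_bipartition[OF F assms(3) this]
  obtain X where sep: "separates X ?F" and cross: "cross_connected n X ?F" by blast
  define c where "c i \<longleftrightarrow> i \<in> X" for i
  have edge: "{i, j} \<in> E \<longleftrightarrow> {i, j} \<notin> ?F" if "i < n" "j < n" "i \<noteq> j" for i j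
    using that assms(1) by (auto simp: compl_edges_def all_pairs_def)
  \<comment> \<open>The weight \<open>1 / n\<close> keeps the row sums at most 1, as a row has at
    most \<open>n\<close> nonzero entries.\<close>
  define M :: "nat \<Rightarrow> nat \<Rightarrow> real"
    where "M i j = (if i < n \<and> j < n \<and> c i \<noteq> c j \<and> {i, j} \<in> E then 1 / n else 0)" for i j
  have bip: "M i j = 0" if "c i = c j" for i j using that by (simp add: M_def)
  interpret symmetric_substochastic n M
  proof
    fix i j
    show "0 \<le> M i j" by (simp add: M_def)
    show "M i j = M j i" by (auto simp: M_def insert_commute)
    have "(\<Sum>j<n. M i j) \<le> (\<Sum>j<n. 1 / real n)" by (intro sum_mono) (simp add: M_def)
    also have "\<dots> \<le> 1" by simp
    finally show "(\<Sum>j<n. M i j) \<le> 1" .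
  qed
  have conn: "\<exists>u\<in>S. \<exists>v\<in>{..<n} - S. 0 < M u v"
    if S: "S \<subseteq> {..<n}" "S \<noteq> {}" "S \<noteq> {..<n}" for S
  proof -
    obtain u v where uv: "u \<in> S" "v \<in> {..<n} - S" "(u \<in> X) \<noteq> (v \<in> X)" "{u, v} \<notin> ?F"
      using cross S unfolding cross_connected_def by meson
    then have "{u, v} \<in> E" using edge[of u v] S(1) by blast
    then have "0 < M u v" using uv S(1) by (auto simp: M_def c_def)
    then show ?thesis using uv by blast
  qed
  define a where "a i j = (if c i then 1 else - 1) * ((if i = j then 1 else 0) - Y i j) + M i j" for i j
  define A where "A = mat n n (\<lambda>(i, j). a i j)"
  have A: "A \<in> carrier_mat n n" by (simp add: A_def)
  have a_sym: "a i j = a j i" for i j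
  proof (cases "c i = c j")
    case True
    then show ?thesis unfolding a_def Y_sym[of j i] sym[of j i] by (simp add: eq_commute)
  next
    case False
    then have "i \<noteq> j" "Y i j = 0" using Y_bipartite[of c i j, OF bip] by blast+
    then show ?thesis unfolding a_def Y_sym[of j i] sym[of j i] by simp
  qed
  \<comment> \<open>Within a class all pairs are edges, and the entry is a positive entry of
    \<open>Y\<close> up to sign. Across the classes \<open>Y\<close> vanishes and \<open>M\<close>
    gives the pattern.\<close>
  have a_pattern: "a i j \<noteq> 0 \<longleftrightarrow> {i, j} \<in> E" if ij: "i < n" "j < n" "i \<noteq> j" for i j
  proof (cases "c i = c j")
    case True
    have "{i, j} \<notin> ?F"
    proof
      assume "{i, j} \<in> ?F"
      then obtain x y where "x \<in> X" "y \<notin> X" "{i, j} = {x, y}"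
        using sep unfolding separates_def by (metis ComplD)
      then show False using True by (simp add: c_def doubleton_eq_iff) metis
    qed
    moreover have "a i j \<noteq> 0"
      using Y_pos_if_connected[of c, OF conn bip ij True] bip[OF True] ij by (simp add: a_def)
    ultimately show ?thesis using edge[OF ij] by simp
  next
    case False
    have "a i j = M i j" using Y_bipartite[of c, OF bip False] ij by (simp add: a_def)
    then show ?thesis using False ij by (simp add: M_def)
  qed
  have "A \<in> sym_matrices n E"
    using a_sym a_pattern A unfolding sym_matrices_def by (auto simp: A_def)
  moreover have "A * A = 1\<^sub>m n"
  proof (rule eq_matI)
    fix i j assume "i < dim_row (1\<^sub>m n :: real mat)" "j < dim_col (1\<^sub>m n :: real mat)"
    then have ij: "i < n" "j < n" by simp_all
    have "(A * A) $$ (i, j) = (\<Sum>l<n. A $$ (i, l) * A $$ (l, j))"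
      by (rule mat_mult_entry[OF A A ij])
    also have "\<dots> = mat_prod n a a i j"
      using ij by (simp add: A_def mat_prod_def)
    also have "\<dots> = (if i = j then 1 else 0)"
      using signed_sqrt_involution[of c, OF bip ij] by (simp add: a_def[abs_def])
    finally show "(A * A) $$ (i, j) = 1\<^sub>m n $$ (i, j)" using ij by simp
  qed (simp_all add: A_def)
  ultimately have "q_graph n E \<le> 2"
    using q_graph_le[of A] card_spectrum_involution_le[OF A] unfolding q_mat_def by fastforce
  moreover have "2 \<le> q_graph n E"
  proof -
    \<comment> \<open>Connectedness of \<open>H\<close> across the cut \<open>{0}\<close> supplies
      an edge at the vertex 0, so no matrix of the graph is diagonal.\<close>
    obtain v where v: "v < n" "v \<noteq> 0" "{0, v} \<in> E"
    proof -
      have "0 \<in> {..<n}" "1 \<in> {..<n}" "1 \<notin> {0 :: nat}" using assms(2) by simp_all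
      then have "{0} \<subseteq> {..<n}" "{0} \<noteq> {..<n}" by blast+
      then obtain v where "v < n" "v \<noteq> 0" "0 < M 0 v" using conn[of "{0}"] by auto
      then show thesis by (intro that[of v]) (simp_all add: M_def split: if_splits)
    qed
    obtain B where B: "B \<in> sym_matrices n E" "q_graph n E = q_mat B"
      using q_graph_attained by blast
    then have "B \<in> carrier_mat n n" "transpose_mat B = B" "B $$ (0, v) \<noteq> 0"
      using v by (auto simp: sym_matrices_def)
    then have "2 \<le> card (spectrum B)"
      using v by (intro two_le_card_spectrum[of B n 0 v]) simp_all
    then show ?thesis using B(2) by (simp add: q_mat_def)
  qed
  ultimately show ?thesis by simp
qed

end
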